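(* Assume that $T$ is finite, let $(\bar c,\bar b)\in\mathbb{R}^p\times\mathbb{R}^T$ and $\bar x\in\mathcal{S}(\bar c,\bar b)$, and assume that $-\bar c\in\mathrm{int}\,A_{\bar b}(\bar x)$. Then $$\mathrm{clm}\,\mathcal{S}\big((\bar c,\bar b),\bar x\big)\ \le\ \max_{D\in\mathcal{T}_{\bar b}(\bar x)}\ \|A_D^{-1}\|.$$
   Context: Setting: $T$ is a finite index set, $a_t\in\mathbb{R}^p$ ($t\in T$) are fixed vectors, and $b=(b_t)_{t\in T}\in\mathbb{R}^T$ with $\|b\|_\infty=\max_{t\in T}|b_t|$. $\mathbb{R}^p$ carries an arbitrary norm $\|\cdot\|$ with dual norm $\|u\|_*=\max_{\|x\|\le1}\langle u,x\rangle$. For $(c,b)\in\mathbb{R}^p\times\mathbb{R}^T$, $P(c,b)$ is the problem: minimize $\langle c,x\rangle$ subject to $\langle a_t,x\rangle\le b_t$ for all $t\in T$. The parameter space has norm $\|(c,b)\|=\max\{\|c\|_*,\|b\|_\infty\}$. $\mathcal{S}(c,b)\subset\mathbb{R}^p$ is the set of optimal solutions of $P(c,b)$. Calmness modulus: for a set-valued mapping $S$ from a metric space $(Y,d_Y)$ to a metric space $(X,d_X)$ and $\bar x\in S(\bar y)$, $\mathrm{clm}\,S(\bar y,\bar x)\in[0,\infty]$ is the infimum of all $\kappa\ge0$ for which there are neighborhoods $U$ of $\bar x$ and $V$ of $\bar y$ with $d_X(x,S(\bar y))\le\kappa\, d_Y(y,\bar y)$ whenever $y\in V$ and $x\in S(y)\cap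 U$ (it is $+\infty$ if no such $\kappa$ exists). For feasible $x$: $T_b(x)=\{t\in T:\langle a_t,x\rangle=b_t\}$ and $A_b(x)=\mathrm{cone}\{a_t:t\in T_b(x)\}$, where $\mathrm{cone}$ is the conical convex hull (always containing $0$). For a finite $D\subset T$, $A_D$ is the matrix whose rows are $a_t'$ (transposes of $a_t$), $t\in D$. Define $$\mathcal{T}_{\bar b}(\bar x)=\{D\subset T_{\bar b}(\bar x): |D|=p,\ A_D\text{ is nonsingular},\ -\bar c\in\mathrm{cone}\{a_t:t\in D\}\}.$$ For such $D$, $A_D$ is viewed as a linear map $(\mathbb{R}^p,\|\cdot\|)\to(\mathbb{R}^D,\|\cdot\|_\infty)$, and $\|A_D^{-1}\|=\max_{\|y\|_\infty\le1}\|A_D^{-1}y\|$. *)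

theory Defs
  imports "HOL-Analysis.Analysis"
begin

text \<open>
  The space \<open>\<real>\<^sup>p\<close> is \<open>real ^ 'n\<close> with \<open>p = CARD('n)\<close>, and \<open>T\<close> is a finite type \<open>'t\<close>.
  Since the norm of \<open>\<real>\<^sup>p\<close> is arbitrary, it is a function \<open>N\<close> and not the class operation
  \<open>norm\<close>, which is the Euclidean norm here.
\<close>

definition is_norm :: "('a::real_vector \<Rightarrow> real) \<Rightarrow> bool" where
  "is_norm N \<longleftrightarrow>
     (\<forall>x. 0 \<le> N x) \<and> (\<forall>x. N x = 0 \<longleftrightarrow> x = 0) \<and>
     (\<forall>r x. N (r *\<^sub>R x) = \<bar>r\<bar> * N x) \<and>
     (\<forall>x y. N (x + y) \<le> N x + N y)"

definition dual_norm :: "('a::real_inner \<Rightarrow> real) \<Rightarrow> 'a \<Rightarrow> real" where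
  "dual_norm N u = (SUP x \<in> {x. N x \<le> 1}. u \<bullet> x)"

definition param_norm :: "(real^'n \<Rightarrow> real) \<Rightarrow> (real^'n) \<times> (real^'t) \<Rightarrow> real" where
  "param_norm N y = max (dual_norm N (fst y)) (infnorm (snd y))"

text \<open>
  The distance from \<open>x\<close> to \<open>S ybar\<close> is taken in \<open>ereal\<close>, so that it is \<open>\<infinity>\<close> if \<open>S ybar\<close> is
  empty; the outer infimum is \<open>\<infinity>\<close> if no \<open>k\<close> qualifies.
\<close>

definition clm ::
  "('y \<Rightarrow> 'y \<Rightarrow> real) \<Rightarrow> ('x \<Rightarrow> 'x \<Rightarrow> real) \<Rightarrow> ('y \<Rightarrow> 'x set) \<Rightarrow> 'y \<Rightarrow> 'x \<Rightarrow> ereal" where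
  "clm dY dX S ybar xbar = Inf {ereal k | k. 0 \<le> k \<and>
     (\<exists>U V. openin (Metric_space.mtopology UNIV dX) U \<and> xbar \<in> U \<and>
            openin (Metric_space.mtopology UNIV dY) V \<and> ybar \<in> V \<and>
            (\<forall>y \<in> V. \<forall>x \<in> S y \<inter> U.
               (INF z \<in> S ybar. ereal (dX x z)) \<le> ereal (k * dY y ybar)))}"

definition feasible_set :: "('t::finite \<Rightarrow> real^'n) \<Rightarrow> real^'t \<Rightarrow> (real^'n) set" where
  "feasible_set a b = {x. \<forall>t. a t \<bullet> x \<le> b $ t}"

definition solution_set :: "('t::finite \<Rightarrow> real^'n) \<Rightarrow> (real^'n) \<times> (real^'t) \<Rightarrow> (real^'n) set" where
  "solution_set a = (\<lambda>(c, b).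
     {x \<in> feasible_set a b. \<forall>z \<in> feasible_set a b. c \<bullet> x \<le> c \<bullet> z})"

definition active_set :: "('t::finite \<Rightarrow> real^'n) \<Rightarrow> real^'t \<Rightarrow> real^'n \<Rightarrow> 't set" where
  "active_set a b x = {t. a t \<bullet> x = b $ t}"

definition active_cone :: "('t::finite \<Rightarrow> real^'n) \<Rightarrow> real^'t \<Rightarrow> real^'n \<Rightarrow> (real^'n) set" where
  "active_cone a b x = convex_cone hull (a ` active_set a b x)"

text \<open>
  The space \<open>\<real>\<^sup>D\<close> is the coordinate subspace of \<open>\<real>\<^sup>T\<close> of the vectors vanishing off \<open>D\<close>, on
  which \<open>infnorm\<close> is the maximum over \<open>D\<close>. Accordingly \<open>row_matrix a D\<close> has the rows \<open>a t\<close> for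
  \<open>t \<in> D\<close>, padded with zero rows for \<open>t \<notin> D\<close>, and it is nonsingular if it is
  invertible as a linear map from \<open>\<real>\<^sup>p\<close> to \<open>\<real>\<^sup>D\<close>.
\<close>

definition coord_space :: "'t::finite set \<Rightarrow> (real^'t) set" where
  "coord_space D = {y. \<forall>t. t \<notin> D \<longrightarrow> y $ t = 0}"

definition row_matrix :: "('t::finite \<Rightarrow> real^'n) \<Rightarrow> 't set \<Rightarrow> real^'n^'t" where
  "row_matrix a D = (\<chi> t. if t \<in> D then a t else 0)"

definition nonsingular_rows :: "('t::finite \<Rightarrow> real^'n) \<Rightarrow> 't set \<Rightarrow> bool" where
  "nonsingular_rows a D \<longleftrightarrow> bij_betw ((*v) (row_matrix a D)) UNIV (coord_space D)"

text \<open>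
  The supremum is that of \<open>N (A\<^sub>D\<^sup>-\<^sup>1 y)\<close> over the \<open>y\<close> in \<open>\<real>\<^sup>D\<close> of maximum norm at most 1;
  it is meaningful only if \<open>nonsingular_rows a D\<close> holds.
\<close>

definition inverse_norm :: "(real^'n \<Rightarrow> real) \<Rightarrow> ('t::finite \<Rightarrow> real^'n) \<Rightarrow> 't set \<Rightarrow> real" where
  "inverse_norm N a D =
     (SUP y \<in> {y \<in> coord_space D. infnorm y \<le> 1}. N (inv ((*v) (row_matrix a D)) y))"

definition basis_family ::
  "('t::finite \<Rightarrow> real^'n) \<Rightarrow> real^'n \<Rightarrow> real^'t \<Rightarrow> real^'n \<Rightarrow> 't set set" where
  "basis_family a c b x = {D. D \<subseteq> active_set a b x \<and> card D = CARD('n) \<and>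
     nonsingular_rows a D \<and> - c \<in> convex_cone hull (a ` D)}"

end

theory Submission
  imports Defs
begin

text \<open>
  Let \<open>x\<close> be optimal for parameters \<open>(c, b)\<close> near \<open>(cbar, bbar)\<close>, with active set \<open>E\<close>. There are finitely
  many cones spanned by subfamilies of the \<open>a t\<close>, and they are closed, so the KKT condition for
  \<open>-c\<close> puts \<open>-cbar\<close> into the cone of \<open>E\<close>. A linear functional \<open>u\<close> is then written as
  \<open>\<Sum>t\<in>D. m t *\<^sub>R a t\<close> for a \<open>D\<close> in the basis family with \<open>m t \<ge> 0\<close> for \<open>t \<notin> E\<close>.
  This sign condition gives
  \<open>u \<bullet> (x - xbar) \<le> infnorm (b - bbar) * (\<Sum>t\<in>D. \<bar>m t\<bar>)\<close>, and the sum is \<open>u\<close> evaluated at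
  the preimage under \<open>A\<^sub>D\<close> of the sign vector of \<open>m\<close>. Taking for \<open>u\<close> a functional
  that separates \<open>x - xbar\<close> from a ball of \<open>N\<close> gives the bound.
\<close>

section \<open>Indexed families: independence, generated cones, Caratheodory reduction\<close>

text \<open>Independence is counted by indices, so a family that repeats a vector is dependent.
  Distinct constraints may share the same \<open>a t\<close>, and \<open>basis_family\<close>
  measures \<open>D\<close> by its number of indices.\<close>

definition independent_family :: "('i \<Rightarrow> 'a::real_vector) \<Rightarrow> 'i set \<Rightarrow> bool" where
  "independent_family a F \<longleftrightarrow>
     (\<forall>g. (\<Sum>t\<in>F. g t *\<^sub>R a t) = 0 \<longrightarrow> (\<forall>t\<in>F. g t = 0))"

text \<open>A repeated vector gives a relation with coefficients 1 and -1, so independence forces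
  injectivity; after that, relations among indices and relations among vectors correspond by
  reindexing.\<close>

lemma independent_family_iff:
  fixes a :: "'i \<Rightarrow> 'a::euclidean_space"
  assumes "finite F"
  shows "independent_family a F \<longleftrightarrow> inj_on a F \<and> independent (a ` F)"
proof
  assume F: "independent_family a F"
  have inj: "inj_on a F"
  proof (rule inj_onI, rule ccontr)
    fix s t assume st: "s \<in> F" "t \<in> F" "a s = a t" "s \<noteq> t"
    let ?g = "\<lambda>i. (if i = s then 1 else 0) - (if i = t then 1 else (0::real))"
    have "(\<Sum>i\<in>F. ?g i *\<^sub>R a i) = 0"
      using assms st by (simp add: scaleR_left_diff_distrib sum_subtractf if_distrib
          [of "\<lambda>r. r *\<^sub>R _"] cong: if_cong)
    with F[unfolded independent_family_def, THEN spec, of ?g]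
    have "\<forall>i\<in>F. ?g i = 0" by (rule mp)
    from bspec[OF this st(1)] st(4) show False by simp
  qed
  moreover have "independent (a ` F)"
  proof (rule independent_if_scalars_zero)
    fix f x assume f: "(\<Sum>x\<in>a ` F. f x *\<^sub>R x) = 0" and "x \<in> a ` F"
    have "(\<Sum>t\<in>F. f (a t) *\<^sub>R a t) = 0"
      using f by (simp add: sum.reindex[OF inj])
    with F[unfolded independent_family_def, THEN spec, of "\<lambda>t. f (a t)"]
    have "\<forall>t\<in>F. f (a t) = 0" by (rule mp)
    then show "f x = 0" using \<open>x \<in> a ` F\<close> by auto
  qed (use assms in auto)
  ultimately show "inj_on a F \<and> independent (a ` F)" ..
next
  assume F: "inj_on a F \<and> independent (a ` F)"
  show "independent_family a F"
    unfolding independent_family_def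
  proof (intro allI impI ballI)
    fix g t assume g: "(\<Sum>t\<in>F. g t *\<^sub>R a t) = 0" and t: "t \<in> F"
    have "\<forall>c. (\<Sum>x\<in>a ` F. c x *\<^sub>R x) = 0 \<longrightarrow> (\<forall>x\<in>a ` F. c x = 0)"
      using F unfolding independent_explicit by blast
    from this[THEN spec, of "\<lambda>x. g (inv_into F a x)"]
    have "\<forall>x\<in>a ` F. g (inv_into F a x) = 0"
      using F g by (simp add: sum.reindex)
    then show "g t = 0" using F t by auto
  qed
qed

text \<open>The nonnegative combinations already form a convex cone containing the generators, and
  each of them arises from 0 by scaling and adding generators. For empty \<open>F\<close> both sides
  are the zero cone.\<close>

lemma convex_cone_hull_finite_family:
  assumes "finite F"
  shows "convex_cone hull (a ` F) = {\<Sum>t\<in>F. g t *\<^sub>R a t | g. \<forall>t\<in>F. 0 \<le> g t}" (is "_ = ?R")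
proof
  show "convex_cone hull (a ` F) \<subseteq> ?R"
  proof (rule hull_minimal)
    show "a ` F \<subseteq> ?R"
    proof clarify
      fix t assume t: "t \<in> F"
      show "\<exists>g. a t = (\<Sum>s\<in>F. g s *\<^sub>R a s) \<and> (\<forall>s\<in>F. 0 \<le> g s)"
        using t assms by (intro exI[of _ "\<lambda>s. if s = t then 1 else 0"])
          (simp add: if_distrib[of "\<lambda>r. r *\<^sub>R _"] cong: if_cong)
    qed
    show "convex_cone ?R"
      unfolding convex_cone_iff
    proof (intro conjI ballI allI impI)
      show "0 \<in> ?R" by (auto intro!: exI[of _ "\<lambda>_. 0"])
    next
      fix x y assume "x \<in> ?R" "y \<in> ?R"
      then obtain g h where "x = (\<Sum>t\<in>F. g t *\<^sub>R a t)" "\<forall>t\<in>F. 0 \<le> g t"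
        "y = (\<Sum>t\<in>F. h t *\<^sub>R a t)" "\<forall>t\<in>F. 0 \<le> h t" by auto
      then show "x + y \<in> ?R"
        by (auto intro!: exI[of _ "\<lambda>t. g t + h t"] simp: scaleR_left_distrib sum.distrib)
    next
      fix x and r :: real assume "x \<in> ?R" "0 \<le> r"
      then obtain g where "x = (\<Sum>t\<in>F. g t *\<^sub>R a t)" "\<forall>t\<in>F. 0 \<le> g t" by auto
      then show "r *\<^sub>R x \<in> ?R" using \<open>0 \<le> r\<close>
        by (auto intro!: exI[of _ "\<lambda>t. r * g t"] simp: scaleR_sum_right)
    qed
  qed
next
  have "(\<Sum>t\<in>F. g t *\<^sub>R a t) \<in> convex_cone hull (a ` F)" if g: "\<forall>t\<in>F. 0 \<le> g t" for g
  proof -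
    have "(\<Sum>t\<in>G. g t *\<^sub>R a t) \<in> convex_cone hull (a ` F)" if "G \<subseteq> F" for G
      using finite_subset[OF that assms] that
    proof (induction G)
      case empty
      then show ?case by (simp add: convex_cone_hull_contains_0)
    next
      case (insert t G)
      then have "g t *\<^sub>R a t \<in> convex_cone hull (a ` F)"
        using g by (intro convex_cone_hull_mul hull_inc) auto
      then show ?case
        using insert by (simp add: convex_cone_hull_add)
    qed
    then show ?thesis by blast
  qed
  then show "?R \<subseteq> convex_cone hull (a ` F)" by auto
qed

text \<open>Caratheodory's theorem for cones is the case \<open>G = {}\<close>.\<close>

lemma caratheodory_relative:
  fixes a :: "'i \<Rightarrow> 'a::real_vector"
  assumes "finite A" "G \<subseteq> A" and G: "independent_family a G"
    and "\<forall>t\<in>A - G. 0 \<le> l t"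
  obtains F m where "G \<subseteq> F" "F \<subseteq> A" "independent_family a F"
    "(\<Sum>t\<in>F. m t *\<^sub>R a t) = (\<Sum>t\<in>A. l t *\<^sub>R a t)" "\<forall>t\<in>F - G. 0 \<le> m t"
  using assms(1,2,4)
proof (induction "card A" arbitrary: A l thesis rule: less_induct)
  case less
  show ?case
  proof (cases "independent_family a A")
    case True
    then show ?thesis using less.prems by blast
  next
    case False
    then obtain h where h: "(\<Sum>t\<in>A. h t *\<^sub>R a t) = 0" "\<exists>t\<in>A. h t \<noteq> 0"
      unfolding independent_family_def by blast
    \<comment> \<open>A relation supported on \<open>G\<close> would be trivial because
      \<open>G\<close> is independent. Hence an index to drop can be sought outside
      \<open>G\<close>.\<close>
    have "\<exists>t\<in>A - G. h t \<noteq> 0"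
    proof (rule ccontr)
      assume "\<not> ?thesis"
      then have 0: "\<forall>t\<in>A - G. h t = 0" by blast
      then have "(\<Sum>t\<in>G. h t *\<^sub>R a t) = (\<Sum>t\<in>A. h t *\<^sub>R a t)"
        using less.prems by (intro sum.mono_neutral_left) auto
      then have "\<forall>t\<in>G. h t = 0" using h G by (simp add: independent_family_def)
      then show False using 0 h by blast
    qed
    then obtain s where s: "s \<in> A - G" "h s \<noteq> 0" by blast
    define g where "g t = (if h s > 0 then h t else - h t)" for t
    have g: "(\<Sum>t\<in>A. g t *\<^sub>R a t) = 0" "g s > 0"
      using h s by (cases "h s > 0"; simp add: g_def sum_negf)+
    define P where "P = {t \<in> A - G. g t > 0}"
    have P: "finite P" "s \<in> P" using less.prems s g by (auto simp: P_def)
    \<comment> \<open>Ratio test: \<open>r\<close> is the largest step for which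
      \<open>l - r * g\<close> stays nonnegative on \<open>A - G\<close>. A minimising index
      \<open>q\<close> gets coefficient 0 and is removed; signs on \<open>G\<close> are left
      free.\<close>
    define r where "r = Min ((\<lambda>t. l t / g t) ` P)"
    have "r \<in> (\<lambda>t. l t / g t) ` P" unfolding r_def using P by (intro Min_in) auto
    then obtain q where q: "q \<in> P" "r = l q / g q" by auto
    have r_le: "r \<le> l t / g t" if "t \<in> P" for t
      unfolding r_def using P that by auto
    have "0 \<le> r" using q less.prems by (auto simp: P_def)
    define k where "k t = l t - r * g t" for t
    have kq: "k q = 0" using q by (auto simp: k_def P_def)
    have k_nonneg: "0 \<le> k t" if "t \<in> A - G" for t
    proof (cases "g t > 0")
      case True
      then show ?thesis using r_le[of t] that by (simp add: P_def k_def pos_le_divide_eq)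
    next
      case False
      then have "r * g t \<le> 0" using \<open>0 \<le> r\<close> by (simp add: mult_nonneg_nonpos)
      then show ?thesis using less.prems(4) that by (force simp: k_def)
    qed
    have q': "q \<in> A" "q \<notin> G" using q by (auto simp: P_def)
    have "(\<Sum>t\<in>A. k t *\<^sub>R a t) = (\<Sum>t\<in>A. l t *\<^sub>R a t) - r *\<^sub>R (\<Sum>t\<in>A. g t *\<^sub>R a t)"
      by (simp add: k_def scaleR_left_diff_distrib sum_subtractf scaleR_sum_right)
    moreover have "(\<Sum>t\<in>A. k t *\<^sub>R a t) = (\<Sum>t\<in>A - {q}. k t *\<^sub>R a t)"
      using less.prems q' kq by (simp add: sum.remove)
    ultimately have sum: "(\<Sum>t\<in>A - {q}. k t *\<^sub>R a t) = (\<Sum>t\<in>A. l t *\<^sub>R a t)"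
      using g by simp
    show ?thesis
    proof (rule less.hyps[of "A - {q}" k])
      show "card (A - {q}) < card A" using less.prems q' by (intro card_Diff1_less)
      fix F m assume "G \<subseteq> F" "F \<subseteq> A - {q}" "independent_family a F"
        "(\<Sum>t\<in>F. m t *\<^sub>R a t) = (\<Sum>t\<in>A - {q}. k t *\<^sub>R a t)" "\<forall>t\<in>F - G. 0 \<le> m t"
      then show thesis using less.prems(1)[of F m] sum by auto
    qed (use less.prems q' k_nonneg in auto)
  qed
qed

text \<open>The completion to a basis takes place among the vectors. One index is then chosen for
  each added vector, while the indices in \<open>F\<close> are kept as they are.\<close>

lemma independent_family_extend:
  fixes a :: "'i \<Rightarrow> 'a::euclidean_space"
  assumes "finite A" "F \<subseteq> A" "independent_family a F" "span (a ` A) = UNIV"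
  obtains D where "F \<subseteq> D" "D \<subseteq> A" "independent_family a D" "card D = DIM('a)"
proof -
  have fF: "finite F" using assms finite_subset by blast
  have F: "inj_on a F" "independent (a ` F)"
    using assms independent_family_iff[OF fF] by auto
  obtain B where B: "a ` F \<subseteq> B" "B \<subseteq> a ` A" "independent B" "a ` A \<subseteq> span B"
    using maximal_independent_subset_extend[of "a ` F" "a ` A"] F assms by blast
  have "span B = UNIV"
    using B(4) assms(4) by (metis span_minimal subspace_span top.extremum_uniqueI)
  then have cB: "card B = DIM('a)"
    using B(3) by (metis dim_UNIV dim_span dim_eq_card_independent)
  define D where "D = F \<union> inv_into A a ` (B - a ` F)"
  have inv: "a (inv_into A a y) = y" "inv_into A a y \<in> A" if "y \<in> B" for y
    using that B by (auto intro: f_inv_into_f inv_into_into)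
  have aD: "a ` D = B"
    using B inv by (auto simp: D_def image_Un image_image)
  have DA: "D \<subseteq> A" using inv assms by (auto simp: D_def)
  have inj: "inj_on a D"
    unfolding D_def
  proof (rule inj_on_Un[THEN iffD2], intro conjI)
    show "inj_on a (inv_into A a ` (B - a ` F))"
      using inv by (auto simp: inj_on_def)
  qed (use F(1) inv in auto)
  show thesis
  proof (rule that)
    show "independent_family a D"
      using independent_family_iff[of D a] inj aD B DA assms finite_subset by metis
    show "card D = DIM('a)" using cB aD card_image[OF inj] by simp
  qed (use DA in \<open>auto simp: D_def\<close>)
qed

text \<open>
  Caratheodory's theorem is applied to \<open>u\<close> in the quotient by the span of an independent
  subfamily of \<open>E\<close> representing \<open>v\<close>. This is why only the coefficients on \<open>E\<close> may be negative.
\<close>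

lemma basis_representation:
  fixes a :: "'i \<Rightarrow> 'a::euclidean_space"
  assumes "finite A" "E \<subseteq> A" "v \<in> convex_cone hull (a ` E)"
    and int: "v \<in> interior (convex_cone hull (a ` A))"
  obtains D m where "D \<subseteq> A" "card D = DIM('a)" "independent_family a D"
    "v \<in> convex_cone hull (a ` D)" "u = (\<Sum>t\<in>D. m t *\<^sub>R a t)" "\<forall>t\<in>D - E. 0 \<le> m t"
proof -
  have fE: "finite E" using assms finite_subset by blast
  obtain l where l: "v = (\<Sum>t\<in>E. l t *\<^sub>R a t)" "\<forall>t\<in>E. 0 \<le> l t"
    using assms(3) unfolding convex_cone_hull_finite_family[OF fE] by auto
  have "independent_family a {}" by (simp add: independent_family_def)
  then obtain G k where G: "G \<subseteq> E" "independent_family a G"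
    "(\<Sum>t\<in>G. k t *\<^sub>R a t) = v" "\<forall>t\<in>G. 0 \<le> k t"
    using caratheodory_relative[OF fE empty_subsetI, of a l] l by (metis Diff_empty)
  have fG: "finite G" "G \<subseteq> A" using G fE assms finite_subset by blast+
  obtain e where e: "e > 0" "cball v e \<subseteq> convex_cone hull (a ` A)"
    using int by (meson mem_interior_cball)
  \<comment> \<open>The step is small enough to keep \<open>v + d *\<^sub>R u\<close> in the cone;
    the 1 in the denominator covers \<open>u = 0\<close>.\<close>
  define d where "d = e / (norm u + 1)"
  have n: "norm u + 1 > 0" by (smt (verit) norm_ge_zero)
  have d: "d > 0" "norm (d *\<^sub>R u) \<le> e"
    using e n by (auto simp: d_def field_simps)
  then have "v + d *\<^sub>R u \<in> convex_cone hull (a ` A)"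
    using e by (intro subsetD[OF e(2)]) (simp add: dist_norm)
  then obtain h where h: "v + d *\<^sub>R u = (\<Sum>t\<in>A. h t *\<^sub>R a t)" "\<forall>t\<in>A. 0 \<le> h t"
    unfolding convex_cone_hull_finite_family[OF assms(1)] by auto
  \<comment> \<open>Subtracting the representation of \<open>v\<close> from that of
    \<open>v + d *\<^sub>R u\<close> and dividing by \<open>d\<close> represents \<open>u\<close>.
    Only coefficients on \<open>G\<close>, hence on \<open>E\<close>, can become negative.\<close>
  define q where "q t = (h t - (if t \<in> G then k t else 0)) / d" for t
  have "(\<Sum>t\<in>A. (if t \<in> G then k t else 0) *\<^sub>R a t) = v"
    unfolding G(3)[symmetric] using fG assms by (intro sum.mono_neutral_cong_right) auto
  then have "(\<Sum>t\<in>A. (h t - (if t \<in> G then k t else 0)) *\<^sub>R a t) = d *\<^sub>R u"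
    by (simp only: scaleR_left_diff_distrib sum_subtractf h(1)[symmetric]) simp
  then have "(1 / d) *\<^sub>R (\<Sum>t\<in>A. (h t - (if t \<in> G then k t else 0)) *\<^sub>R a t) = u"
    using d by simp
  then have q: "u = (\<Sum>t\<in>A. q t *\<^sub>R a t)"
    by (simp add: q_def scaleR_sum_right)
  have "\<forall>t\<in>A - G. 0 \<le> q t" using h d by (simp add: q_def)
  then obtain F m where F: "G \<subseteq> F" "F \<subseteq> A" "independent_family a F"
    "(\<Sum>t\<in>F. m t *\<^sub>R a t) = u" "\<forall>t\<in>F - G. 0 \<le> m t"
    using caratheodory_relative[of A G a q] assms fG G q by metis
  \<comment> \<open>A proper subspace has empty interior, so the interior point \<open>v\<close>
    forces the generators to span.\<close>
  have "span (a ` A) = UNIV"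
  proof -
    have "convex_cone hull (a ` A) \<subseteq> span (a ` A)"
      by (intro hull_minimal span_superset subspace_imp_convex_cone subspace_span)
    then have "interior (span (a ` A)) \<noteq> {}" using int interior_mono by blast
    then show ?thesis by (metis dim_eq_full dim_span empty_interior_lowdim
        dim_subset_UNIV order_le_less)
  qed
  then obtain D where D: "F \<subseteq> D" "D \<subseteq> A" "independent_family a D" "card D = DIM('a)"
    using independent_family_extend[of A F a] assms F by metis
  have fD: "finite D" using D assms finite_subset by blast
  show thesis
  proof (rule that)
    have "v \<in> convex_cone hull (a ` G)"
      unfolding convex_cone_hull_finite_family[OF fG(1)] using G by blast
    then show "v \<in> convex_cone hull (a ` D)"
      using F D by (meson hull_mono image_mono subset_iff)
    \<comment> \<open>The indices added to complete the basis get coefficient 0, so the sign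
      condition carries over from \<open>F\<close>.\<close>
    show "u = (\<Sum>t\<in>D. (if t \<in> F then m t else 0) *\<^sub>R a t)"
      unfolding F(4)[symmetric] using D fD by (intro sum.mono_neutral_cong_left) auto
    show "\<forall>t\<in>D - E. 0 \<le> (if t \<in> F then m t else 0)" using F G by auto
  qed (use D in auto)
qed

section \<open>Arbitrary norms, the dual norm and the parameter norm\<close>

lemma is_normD:
  assumes "is_norm N"
  shows "0 \<le> N x" "N x = 0 \<longleftrightarrow> x = 0" "N (r *\<^sub>R x) = \<bar>r\<bar> * N x" "N (x + y) \<le> N x + N y"
  using assms unfolding is_norm_def by blast+

lemma is_norm_zero:
  assumes "is_norm N"
  shows "N 0 = 0"
  using is_normD(2)[OF assms, of 0] by simp

lemma is_norm_minus:
  assumes "is_norm N"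
  shows "N (- x) = N x"
  using is_normD(3)[OF assms, of "-1" x] by simp

lemma Metric_space_is_norm:
  assumes N: "is_norm N"
  shows "Metric_space UNIV (\<lambda>x y. N (x - y))"
proof
  fix x y z
  show "0 \<le> N (x - y)" using is_normD(1)[OF N] .
  show "N (x - y) = N (y - x)" using is_norm_minus[OF N, of "y - x"] by simp
  show "N (x - y) = 0 \<longleftrightarrow> x = y" using is_normD(2)[OF N] by simp
  show "N (x - z) \<le> N (x - y) + N (y - z)" using is_normD(4)[OF N, of "x - y" "y - z"] by simp
qed

text \<open>Expand \<open>x\<close> in the standard basis and bound each coordinate by the Euclidean
  norm. The 1 added to the constant makes its positivity immediate.\<close>

lemma is_norm_le_norm:
  fixes N :: "'a::euclidean_space \<Rightarrow> real"
  assumes N: "is_norm N"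
  obtains C where "C > 0" "\<And>x. N x \<le> C * norm x"
proof
  let ?C = "(\<Sum>i\<in>Basis. N i) + 1"
  have S: "0 \<le> (\<Sum>i\<in>Basis. N i)" by (simp add: sum_nonneg is_normD(1)[OF N])
  then show "?C > 0" by simp
  fix x :: 'a
  have "N (\<Sum>i\<in>B. (x \<bullet> i) *\<^sub>R i) \<le> (\<Sum>i\<in>B. N ((x \<bullet> i) *\<^sub>R i))" if "finite B" for B
    using that by induction (auto simp: is_norm_zero[OF N] intro: order_trans[OF is_normD(4)[OF N]])
  from this[OF finite_Basis] have "N x \<le> (\<Sum>i\<in>Basis. \<bar>x \<bullet> i\<bar> * N i)"
    by (simp add: euclidean_representation is_normD(3)[OF N])
  also have "\<dots> \<le> (\<Sum>i\<in>Basis. norm x * N i)"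
    by (intro sum_mono mult_right_mono Basis_le_norm is_normD(1)[OF N])
  also have "\<dots> = norm x * (\<Sum>i\<in>Basis. N i)" by (simp add: sum_distrib_left)
  also have "\<dots> \<le> ?C * norm x" by (simp add: algebra_simps)
  finally show "N x \<le> ?C * norm x" .
qed

lemma continuous_on_is_norm:
  fixes N :: "'a::euclidean_space \<Rightarrow> real"
  assumes N: "is_norm N"
  shows "continuous_on S N"
proof -
  obtain C where C: "C > 0" "\<And>x. N x \<le> C * norm x" using is_norm_le_norm[OF N] by blast
  have "C-lipschitz_on S N"
  proof (rule lipschitz_onI)
    fix x y
    have "\<bar>N x - N y\<bar> \<le> N (x - y)"
      using is_normD(4)[OF N, of "x - y" y] is_normD(4)[OF N, of "y - x" x]
        is_norm_minus[OF N, of "x - y"] by simp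
    then show "dist (N x) (N y) \<le> C * dist x y"
      using C(2)[of "x - y"] by (simp add: dist_norm)
  qed (use C in simp)
  then show ?thesis by (rule lipschitz_on_continuous_on)
qed

text \<open>By compactness \<open>N\<close> attains a minimum on the Euclidean unit sphere, which is
  positive; homogeneity extends the estimate to all vectors.\<close>

lemma norm_le_is_norm:
  fixes N :: "'a::euclidean_space \<Rightarrow> real"
  assumes N: "is_norm N"
  obtains C where "C > 0" "\<And>x. norm x \<le> C * N x"
proof -
  have ne: "sphere (0::'a) 1 \<noteq> {}" by simp
  obtain z where z: "z \<in> sphere 0 1" "\<And>x. x \<in> sphere 0 1 \<Longrightarrow> N z \<le> N x"
    using continuous_attains_inf[OF compact_sphere ne continuous_on_is_norm[OF N]] by blast
  have "z \<noteq> 0" using z(1) by auto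
  then have pos: "N z > 0" using is_normD(1,2)[OF N, of z] by simp
  show thesis
  proof
    show "1 / N z > 0" using pos by simp
    fix x :: 'a
    show "norm x \<le> 1 / N z * N x"
    proof (cases "x = 0")
      case False
      then have "N z \<le> N ((1 / norm x) *\<^sub>R x)" by (intro z(2)) simp
      then show ?thesis using False pos by (simp add: is_normD(3)[OF N] field_simps)
    qed (simp add: is_norm_zero[OF N])
  qed
qed

text \<open>The content is boundedness: the real supremum dominates its values only once they are
  bounded above, which follows from Cauchy-Schwarz and the comparison of norms.\<close>

lemma dual_norm_ge:
  fixes N :: "'a::euclidean_space \<Rightarrow> real"
  assumes N: "is_norm N" and "N x \<le> 1"
  shows "u \<bullet> x \<le> dual_norm N u"
proof -
  obtain C where C: "C > 0" "\<And>x. norm x \<le> C * N x" using norm_le_is_norm[OF N] by blast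
  have "u \<bullet> y \<le> norm u * C" if "N y \<le> 1" for y
  proof -
    have "norm y \<le> C" using C(2)[of y] that C(1) mult_left_mono[of "N y" 1 C] by linarith
    then show ?thesis using norm_cauchy_schwarz[of u y] mult_left_mono[of "norm y" C "norm u"] by simp
  qed
  then have "bdd_above ((\<lambda>x. u \<bullet> x) ` {x. N x \<le> 1})"
    by (intro bdd_aboveI2[where M = "norm u * C"]) simp
  then show ?thesis unfolding dual_norm_def using assms by (intro cSUP_upper) auto
qed

lemma dual_norm_le:
  assumes N: "is_norm N" and "\<And>x. N x \<le> 1 \<Longrightarrow> u \<bullet> x \<le> r"
  shows "dual_norm N u \<le> r"
proof -
  have "N 0 \<le> 1" using is_norm_zero[OF N] by simp
  then show ?thesis unfolding dual_norm_def using assms by (intro cSUP_least) auto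
qed

lemma is_norm_dual_norm:
  fixes N :: "'a::euclidean_space \<Rightarrow> real"
  assumes N: "is_norm N"
  shows "is_norm (dual_norm N)"
  unfolding is_norm_def
proof (intro conjI allI)
  have N0: "N 0 \<le> 1" using is_norm_zero[OF N] by simp
  have nonneg: "0 \<le> dual_norm N u" for u using dual_norm_ge[OF N N0, of u] by simp
  have pos: "0 < dual_norm N u" if "u \<noteq> 0" for u
  proof -
    have Nu: "N u > 0" using is_normD(1,2)[OF N, of u] that by simp
    then have "u \<bullet> ((1 / N u) *\<^sub>R u) \<le> dual_norm N u"
      by (intro dual_norm_ge[OF N]) (simp add: is_normD(3)[OF N])
    moreover have "u \<bullet> ((1 / N u) *\<^sub>R u) > 0" using that Nu by simp
    ultimately show ?thesis by linarith
  qed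
  have 0: "dual_norm N 0 = 0"
    using dual_norm_le[OF N, of 0 0] nonneg[of 0] by simp
  have scale_le: "dual_norm N (r *\<^sub>R u) \<le> \<bar>r\<bar> * dual_norm N u" for r u
  proof (rule dual_norm_le[OF N])
    fix x assume x: "N x \<le> 1"
    \<comment> \<open>The sign of \<open>r\<close> is moved onto \<open>x\<close>, which keeps it in
      the unit ball of \<open>N\<close>.\<close>
    have "\<bar>r\<bar> * (u \<bullet> (sgn r *\<^sub>R x)) \<le> \<bar>r\<bar> * dual_norm N u"
      using x by (intro mult_left_mono dual_norm_ge[OF N])
        (auto simp: is_normD(3)[OF N] sgn_real_def is_normD(1)[OF N])
    then show "(r *\<^sub>R u) \<bullet> x \<le> \<bar>r\<bar> * dual_norm N u"
      by (simp add: abs_sgn[of r] sgn_real_def split: if_splits)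
  qed
  fix x y :: 'a and r :: real
  show "0 \<le> dual_norm N x" by (rule nonneg)
  show "dual_norm N x = 0 \<longleftrightarrow> x = 0" using pos[of x] 0 by fastforce
  show "dual_norm N (r *\<^sub>R x) = \<bar>r\<bar> * dual_norm N x"
  proof (cases "r = 0")
    case False
    \<comment> \<open>The reverse inequality is the same estimate for the factor
      \<open>1 / r\<close> and the vector \<open>r *\<^sub>R x\<close>.\<close>
    have "\<bar>r\<bar> * dual_norm N ((1 / r) *\<^sub>R (r *\<^sub>R x)) \<le> \<bar>r\<bar> * (\<bar>1 / r\<bar> * dual_norm N (r *\<^sub>R x))"
      by (intro mult_left_mono scale_le) simp
    then show ?thesis using False scale_le[of r x] by simp
  qed (simp add: 0)
  show "dual_norm N (x + y) \<le> dual_norm N x + dual_norm N y"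
    by (rule dual_norm_le[OF N])
      (auto simp: inner_left_distrib intro!: add_mono dual_norm_ge[OF N])
qed

lemma is_norm_param_norm:
  assumes N: "is_norm N"
  shows "is_norm (param_norm N)"
proof -
  note D = is_norm_dual_norm[OF N]
  show ?thesis
    unfolding is_norm_def
  proof (intro conjI allI)
    fix x y :: "(real^'a) \<times> (real^'b)" and r :: real
    show "0 \<le> param_norm N x"
      by (simp add: param_norm_def infnorm_pos_le le_max_iff_disj)
    show "param_norm N x = 0 \<longleftrightarrow> x = 0"
      using is_normD(1,2)[OF D, of "fst x"] infnorm_pos_le[of "snd x"] infnorm_eq_0[of "snd x"]
      by (auto simp: param_norm_def prod_eq_iff max_def)
    show "param_norm N (r *\<^sub>R x) = \<bar>r\<bar> * param_norm N x"
      by (simp add: param_norm_def is_normD(3)[OF D] infnorm_mul max_mult_distrib_left)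
    show "param_norm N (x + y) \<le> param_norm N x + param_norm N y"
      using is_normD(4)[OF D, of "fst x" "fst y"] infnorm_triangle[of "snd x" "snd y"]
      by (auto simp: param_norm_def)
  qed
qed

section \<open>Nonsingular row matrices and the norm of the inverse\<close>

text \<open>The rows span the whole space, so a vector in the kernel is orthogonal to itself and
  vanishes. Surjectivity onto \<open>coord_space D\<close> follows by counting dimensions.\<close>

lemma nonsingular_rows_independent_family:
  fixes a :: "'t::finite \<Rightarrow> real^'n"
  assumes "independent_family a D" "card D = CARD('n)"
  shows "nonsingular_rows a D"
proof -
  let ?f = "(*v) (row_matrix a D)"
  have f: "?f x $ t = (if t \<in> D then a t \<bullet> x else 0)" for x t
    by (simp add: row_matrix_def matrix_vector_mult_def inner_vec_def)
  have lin: "linear ?f" by simp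
  have indep: "inj_on a D" "independent (a ` D)"
    using assms independent_family_iff[of D a] by auto
  then have span: "span (a ` D) = UNIV"
    using assms card_image[OF indep(1)]
    by (metis (mono_tags, lifting) DIM_cart DIM_real dim_UNIV dim_eq_full dim_eq_card_independent mult.right_neutral)
  have "inj ?f"
  proof (rule linear_injective_0[THEN iffD2, OF lin], intro allI impI)
    fix x assume "?f x = 0"
    then have "a t \<bullet> x = 0" if "t \<in> D" for t using f[of x t] that by simp
    then have "orthogonal x y" if "y \<in> a ` D" for y
      using that by (auto simp: orthogonal_def inner_commute)
    then have "orthogonal x x" using orthogonal_to_span[of x "a ` D"] span by blast
    then show "x = 0" by (simp add: orthogonal_self)
  qed
  moreover have "range ?f = coord_space D"
  proof (rule subspace_dim_equal)
    show "subspace (range ?f)" using lin linear_subspace_image subspace_UNIV by blast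
    show "subspace (coord_space D)" by (auto simp: coord_space_def subspace_def)
    show "range ?f \<subseteq> coord_space D" by (auto simp: coord_space_def f)
    have "dim (coord_space D) = card D"
      using dim_substandard_cart[of D, where 'a = real]
      by (simp add: coord_space_def dim_vec_eq)
    then show "dim (coord_space D) \<le> dim (range ?f)"
      using dim_image_eq[OF lin, of UNIV] \<open>inj ?f\<close> assms by simp
  qed
  ultimately show ?thesis by (simp add: nonsingular_rows_def bij_betw_def)
qed

lemma infnorm_le_iff_cart: "infnorm (x::real^'n) \<le> r \<longleftrightarrow> (\<forall>i. \<bar>x $ i\<bar> \<le> r)"
proof
  show "infnorm x \<le> r \<Longrightarrow> \<forall>i. \<bar>x $ i\<bar> \<le> r"
    using component_le_infnorm_cart order_trans by blast
  show "\<forall>i. \<bar>x $ i\<bar> \<le> r \<Longrightarrow> infnorm x \<le> r"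
    unfolding infnorm_cart by (intro cSup_least) auto
qed

text \<open>The vector \<open>x\<close> is the preimage of its own image under the row matrix, and
  the assumption puts that image into the unit ball of the maximum norm.\<close>

lemma inverse_norm_ge:
  fixes N :: "real^'n \<Rightarrow> real" and a :: "'t::finite \<Rightarrow> real^'n"
  assumes N: "is_norm N" and D: "nonsingular_rows a D" and x: "\<And>t. t \<in> D \<Longrightarrow> \<bar>a t \<bullet> x\<bar> \<le> 1"
  shows "N x \<le> inverse_norm N a D"
proof -
  let ?f = "(*v) (row_matrix a D)"
  have f: "?f x $ t = (if t \<in> D then a t \<bullet> x else 0)" for x t
    by (simp add: row_matrix_def matrix_vector_mult_def inner_vec_def)
  have inj: "inj ?f" and ran: "range ?f = coord_space D"
    using D by (auto simp: nonsingular_rows_def bij_betw_def)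
  obtain B where B: "B > 0" "\<And>x. B * norm x \<le> norm (?f x)"
    using linear_inj_bounded_below_pos[of ?f] inj by auto
  obtain C where C: "C > 0" "\<And>x. N x \<le> C * norm x" using is_norm_le_norm[OF N] by blast
  \<comment> \<open>A crude bound, whose only purpose is that the supremum defining
    \<open>inverse_norm\<close> is taken over a bounded set.\<close>
  have "N (inv ?f y) \<le> C * (sqrt DIM(real^'t) / B)" if "y \<in> coord_space D" "infnorm y \<le> 1" for y
  proof -
    have "?f (inv ?f y) = y" using that ran by (simp add: f_inv_into_f)
    then have "B * norm (inv ?f y) \<le> norm y" using B(2)[of "inv ?f y"] by simp
    also have "\<dots> \<le> sqrt DIM(real^'t) * infnorm y" by (rule norm_le_infnorm)
    also have "\<dots> \<le> sqrt DIM(real^'t)" using that by (simp add: mult_left_le)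
    finally have "norm (inv ?f y) \<le> sqrt DIM(real^'t) / B" using B by (simp add: field_simps)
    then have "C * norm (inv ?f y) \<le> C * (sqrt DIM(real^'t) / B)"
      using C by (intro mult_left_mono) auto
    then show ?thesis using C(2)[of "inv ?f y"] by linarith
  qed
  then have "bdd_above ((\<lambda>y. N (inv ?f y)) ` {y \<in> coord_space D. infnorm y \<le> 1})"
    by (intro bdd_aboveI2) auto
  moreover have "?f x \<in> {y \<in> coord_space D. infnorm y \<le> 1}"
    using ran x by (auto simp: infnorm_le_iff_cart f)
  ultimately have "N (inv ?f (?f x)) \<le> inverse_norm N a D"
    unfolding inverse_norm_def by (rule cSUP_upper[rotated])
  then show ?thesis using inj by simp
qed

section \<open>Optimality conditions\<close>

text \<open>If \<open>-c\<close> lay outside the closed cone, a separating vector \<open>u\<close>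
  would make \<open>-u\<close> a descent direction along which \<open>x\<close> stays feasible for
  small steps.\<close>

lemma solution_set_KKT:
  fixes a :: "'t::finite \<Rightarrow> real^'n"
  assumes x: "x \<in> solution_set a (c, b)"
  shows "- c \<in> active_cone a b x"
proof (rule ccontr)
  let ?E = "active_set a b x" and ?K = "active_cone a b x"
  assume "- c \<notin> ?K"
  moreover have "closed ?K" "convex ?K"
    by (simp_all add: active_cone_def closed_convex_cone_hull convex_convex_cone_hull)
  ultimately obtain u r where u: "u \<bullet> (- c) < r" "\<And>y. y \<in> ?K \<Longrightarrow> u \<bullet> y > r"
    using separating_hyperplane_closed_point[of ?K "- c"] by blast
  have "r < 0" using u(2)[of 0] by (simp add: active_cone_def convex_cone_hull_contains_0)
  have act: "0 \<le> u \<bullet> a t" if t: "t \<in> ?E" for t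
  proof (rule ccontr)
    assume neg: "\<not> 0 \<le> u \<bullet> a t"
    \<comment> \<open>The factor is positive and chosen so that \<open>u\<close> takes exactly the
      value \<open>r\<close> at this point of the cone, where only values above \<open>r\<close> are
      allowed.\<close>
    have "(r / (u \<bullet> a t)) *\<^sub>R a t \<in> ?K"
      unfolding active_cone_def using t neg \<open>r < 0\<close>
      by (intro convex_cone_hull_mul hull_inc) (auto simp: divide_nonpos_nonpos)
    then show False using u(2) neg by fastforce
  qed
  have "\<forall>t. \<forall>\<^sub>F e in at_right (0::real). a t \<bullet> (x - e *\<^sub>R u) \<le> b $ t"
  proof
    fix t
    show "\<forall>\<^sub>F e in at_right (0::real). a t \<bullet> (x - e *\<^sub>R u) \<le> b $ t"
    proof (cases "t \<in> ?E")
      case True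
      then show ?thesis using act[OF True]
        by (intro eventually_at_right_less[THEN eventually_mono])
          (auto simp: active_set_def inner_diff_right inner_commute)
    next
      case False
      then have "a t \<bullet> x < b $ t"
        using x by (auto simp: solution_set_def feasible_set_def active_set_def order_less_le)
      moreover have "((\<lambda>e. a t \<bullet> (x - e *\<^sub>R u)) \<longlongrightarrow> a t \<bullet> (x - 0 *\<^sub>R u)) (at_right 0)"
        by (intro tendsto_intros)
      ultimately have "\<forall>\<^sub>F e in at_right (0::real). a t \<bullet> (x - e *\<^sub>R u) < b $ t"
        by (intro order_tendstoD(2)[where y = "a t \<bullet> x"]) auto
      then show ?thesis by eventually_elim simp
    qed
  qed
  \<comment> \<open>Finitely many constraints allow one step length to serve all of them.\<close>
  then have "\<forall>\<^sub>F e in at_right (0::real). \<forall>t. a t \<bullet> (x - e *\<^sub>R u) \<le> b $ t"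
    by (simp add: eventually_all_finite)
  then have "\<forall>\<^sub>F e in at_right (0::real). (\<forall>t. a t \<bullet> (x - e *\<^sub>R u) \<le> b $ t) \<and> 0 < e"
    using eventually_at_right_less by (rule eventually_conj)
  then have "\<exists>e. (\<forall>t. a t \<bullet> (x - e *\<^sub>R u) \<le> b $ t) \<and> 0 < e"
    by (intro eventually_happens'[OF trivial_limit_at_right_real])
  then obtain e where e: "x - e *\<^sub>R u \<in> feasible_set a b" "e > 0"
    unfolding feasible_set_def by blast
  then have "e * (u \<bullet> c) \<le> 0"
    using x by (auto simp: solution_set_def inner_diff_right inner_commute)
  then show False using e u(1) \<open>r < 0\<close> by (simp add: mult_le_0_iff)
qed

text \<open>The calmness modulus refers to the topologies of the given norms, whereas its
  neighbourhoods are built below as Euclidean open sets.\<close>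

lemma openin_mtopology_is_norm:
  fixes N :: "'a::euclidean_space \<Rightarrow> real"
  assumes N: "is_norm N" and "open U"
  shows "openin (Metric_space.mtopology UNIV (\<lambda>x y. N (x - y))) U"
proof -
  interpret M: Metric_space UNIV "\<lambda>x y. N (x - y)" by (rule Metric_space_is_norm[OF N])
  obtain C where C: "C > 0" "\<And>x. norm x \<le> C * N x" using norm_le_is_norm[OF N] by blast
  have "\<exists>r>0. M.mball x r \<subseteq> U" if x: "x \<in> U" for x
  proof -
    obtain e where e: "e > 0" "ball x e \<subseteq> U" using openE[OF assms(2) x] by blast
    have "M.mball x (e / C) \<subseteq> U"
    proof
      fix y assume "y \<in> M.mball x (e / C)"
      then have "C * N (x - y) < e" using C by (simp add: pos_less_divide_eq mult.commute)
      then have "y \<in> ball x e" using C(2)[of "x - y"] by (simp add: dist_norm)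
      then show "y \<in> U" using e by blast
    qed
    then show ?thesis using e C by (intro exI[of _ "e / C"]) simp
  qed
  then show ?thesis by (simp add: M.openin_mtopology)
qed

section \<open>The distance bound for a perturbed feasible point\<close>

text \<open>Passes from independent families to nonsingular matrices. Any choice of \<open>u\<close>
  also shows that the basis family is nonempty.\<close>

lemma basis_family_representation:
  fixes a :: "'t::finite \<Rightarrow> real^'n"
  assumes "E \<subseteq> active_set a b x" "- c \<in> convex_cone hull (a ` E)"
    and "- c \<in> interior (active_cone a b x)"
  obtains D m where "D \<in> basis_family a c b x" "u = (\<Sum>t\<in>D. m t *\<^sub>R a t)" "\<forall>t\<in>D - E. 0 \<le> m t"
proof -
  obtain D m where D: "D \<subseteq> active_set a b x" "card D = DIM(real^'n)" "independent_family a D"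
    "- c \<in> convex_cone hull (a ` D)" "u = (\<Sum>t\<in>D. m t *\<^sub>R a t)" "\<forall>t\<in>D - E. 0 \<le> m t"
    using basis_representation[of "active_set a b x" E "- c" a u] assms
    unfolding active_cone_def by auto
  then have "nonsingular_rows a D" by (intro nonsingular_rows_independent_family) auto
  then have "D \<in> basis_family a c b x" using D by (simp add: basis_family_def)
  then show thesis using that D by blast
qed

lemma inverse_norm_nonneg:
  fixes N :: "real^'n \<Rightarrow> real" and a :: "'t::finite \<Rightarrow> real^'n"
  assumes "is_norm N" "nonsingular_rows a D"
  shows "0 \<le> inverse_norm N a D"
  using inverse_norm_ge[OF assms, of 0] is_norm_zero[OF assms(1)] by simp

text \<open>If \<open>x - xbar\<close> lay outside the ball of radius \<open>?k * ?d\<close>, some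
  functional would be strictly larger there than on the whole ball. A basis \<open>D\<close> adapted
  to that functional yields a point of the ball where it is at least as large.\<close>

lemma feasible_point_distance_bound:
  fixes N :: "real^'n \<Rightarrow> real" and a :: "'t::finite \<Rightarrow> real^'n"
  assumes N: "is_norm N"
    and int: "- cbar \<in> interior (active_cone a bbar xbar)"
    and sub: "active_set a b x \<subseteq> active_set a bbar xbar"
    and feas: "x \<in> feasible_set a b"
    and cone: "- cbar \<in> active_cone a b x"
  shows "N (x - xbar) \<le> Max (inverse_norm N a ` basis_family a cbar bbar xbar) * infnorm (b - bbar)"
proof (rule ccontr)
  let ?k = "Max (inverse_norm N a ` basis_family a cbar bbar xbar)"
  let ?d = "infnorm (b - bbar)" and ?E = "active_set a b x" and ?w = "x - xbar"
  let ?S = "{z. N z \<le> ?k * ?d}"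
  assume "\<not> ?thesis"
  then have "?w \<notin> ?S" by simp
  moreover have "closed ?S"
    by (intro closed_Collect_le continuous_on_is_norm[OF N] continuous_on_const)
  moreover have "convex ?S"
  proof (rule convexI, clarify)
    fix y z and s t :: real
    assume "N y \<le> ?k * ?d" "N z \<le> ?k * ?d" "0 \<le> s" "0 \<le> t" "s + t = 1"
    moreover have "N (s *\<^sub>R y + t *\<^sub>R z) \<le> s * N y + t * N z"
      using is_normD(4)[OF N, of "s *\<^sub>R y" "t *\<^sub>R z"] calculation by (simp add: is_normD(3)[OF N])
    ultimately show "N (s *\<^sub>R y + t *\<^sub>R z) \<le> ?k * ?d"
      using convex_bound_le[of "N y" "?k * ?d" "N z" s t] by linarith
  qed
  ultimately obtain v r where v: "v \<bullet> ?w < r" "\<And>z. z \<in> ?S \<Longrightarrow> v \<bullet> z > r"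
    using separating_hyperplane_closed_point[of ?S ?w] by blast
  \<comment> \<open>The functional is \<open>-v\<close>, since the separation makes \<open>v\<close>
    smaller at \<open>?w\<close> than on the ball.\<close>
  obtain D m where D: "D \<in> basis_family a cbar bbar xbar"
    and m: "- v = (\<Sum>t\<in>D. m t *\<^sub>R a t)" "\<forall>t\<in>D - ?E. 0 \<le> m t"
    using basis_family_representation[OF sub _ int, of "- v"] cone unfolding active_cone_def by blast
  have ns: "nonsingular_rows a D" and Dact: "D \<subseteq> active_set a bbar xbar"
    using D by (auto simp: basis_family_def)
  \<comment> \<open>The preimage \<open>y\<close> of the sign vector turns each
    \<open>m t * (a t \<bullet> y)\<close> into \<open>\<bar>m t\<bar>\<close>, and
    \<open>N y\<close> is at most the norm of the inverse.\<close>
  have "(\<chi> t. if t \<in> D then sgn (m t) else 0) \<in> range ((*v) (row_matrix a D))"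
    using ns by (simp add: nonsingular_rows_def bij_betw_def coord_space_def)
  then obtain y where y: "(\<chi> t. if t \<in> D then sgn (m t) else 0) = row_matrix a D *v y" by blast
  have ay: "a t \<bullet> y = sgn (m t)" if "t \<in> D" for t
    using arg_cong[OF y, of "\<lambda>z. z $ t"] that
    by (simp add: row_matrix_def matrix_vector_mult_def inner_vec_def)
  have "N y \<le> inverse_norm N a D"
    by (rule inverse_norm_ge[OF N ns]) (simp add: ay sgn_real_def)
  also have "\<dots> \<le> ?k" using D by (intro Max_ge) auto
  finally have "?d * N y \<le> ?d * ?k" by (intro mult_left_mono infnorm_pos_le)
  then have "?d *\<^sub>R y \<in> ?S"
    by (simp add: is_normD(3)[OF N] real_abs_infnorm mult.commute[of ?k])
  then have "- v \<bullet> (?d *\<^sub>R y) < - v \<bullet> ?w" using v by fastforce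
  also have "- v \<bullet> ?w = (\<Sum>t\<in>D. m t * (a t \<bullet> ?w))" by (simp add: m(1) inner_sum_left)
  also have "\<dots> \<le> (\<Sum>t\<in>D. \<bar>m t\<bar> * ?d)"
  proof (rule sum_mono)
    fix t assume t: "t \<in> D"
    \<comment> \<open>On \<open>?E\<close> this quantity is \<open>b $ t - bbar $ t\<close>, bounded
      in absolute value. Off \<open>?E\<close> feasibility bounds it only from above, which suffices
      because \<open>m t\<close> is nonnegative there.\<close>
    have w: "a t \<bullet> ?w = a t \<bullet> x - bbar $ t"
      using t Dact by (auto simp: active_set_def inner_diff_right)
    have b: "\<bar>b $ t - bbar $ t\<bar> \<le> ?d" using component_le_infnorm_cart[of "b - bbar" t] by simp
    show "m t * (a t \<bullet> ?w) \<le> \<bar>m t\<bar> * ?d"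
    proof (cases "t \<in> ?E")
      case True
      then have "\<bar>a t \<bullet> ?w\<bar> \<le> ?d" using w b by (simp add: active_set_def)
      then have "\<bar>m t * (a t \<bullet> ?w)\<bar> \<le> \<bar>m t\<bar> * ?d" by (simp add: abs_mult mult_left_mono)
      then show ?thesis by linarith
    next
      case False
      have "a t \<bullet> x \<le> b $ t" using feas by (simp add: feasible_set_def)
      then have "a t \<bullet> ?w \<le> ?d" using w b by linarith
      moreover have "0 \<le> m t" using m(2) t False by blast
      ultimately show ?thesis by (simp add: mult_left_mono)
    qed
  qed
  also have "\<dots> = (\<Sum>t\<in>D. m t * (a t \<bullet> y) * ?d)"
    by (intro sum.cong) (simp_all add: ay abs_sgn)
  also have "\<dots> = - v \<bullet> (?d *\<^sub>R y)"
    by (simp only: m(1) inner_sum_left inner_scaleR_left inner_scaleR_right sum_distrib_left mult_ac)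
  finally show False by simp
qed

section \<open>The bound on the calmness modulus\<close>

theorem theorem13:
  fixes N :: "real^'n \<Rightarrow> real"
    and a :: "'t::finite \<Rightarrow> real^'n"
    and cbar xbar :: "real^'n"
    and bbar :: "real^'t"
  assumes "is_norm N"
    and "xbar \<in> solution_set a (cbar, bbar)"
    and "- cbar \<in> interior (active_cone a bbar xbar)"
  shows "clm (\<lambda>y y'. param_norm N (y - y')) (\<lambda>x x'. N (x - x'))
             (solution_set a) (cbar, bbar) xbar
         \<le> ereal (Max (inverse_norm N a ` basis_family a cbar bbar xbar))"
proof -
  let ?k = "Max (inverse_norm N a ` basis_family a cbar bbar xbar)"
  let ?A = "active_set a bbar xbar"
  note N = assms(1) and xbar = assms(2) and int = assms(3)
  have "- cbar \<in> active_cone a bbar xbar" using int interior_subset by blast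
  \<comment> \<open>Representing the arbitrary vector 0 shows that the basis family is nonempty, so
    that the maximum is a genuine one and is nonnegative.\<close>
  then obtain D where D: "D \<in> basis_family a cbar bbar xbar"
    using basis_family_representation[OF order_refl _ int, of 0] unfolding active_cone_def by blast
  have "0 \<le> inverse_norm N a D"
    using D by (intro inverse_norm_nonneg[OF N]) (simp add: basis_family_def)
  also have "\<dots> \<le> ?k" using D by (intro Max_ge) auto
  finally have k: "0 \<le> ?k" .
  \<comment> \<open>The slack of a constraint inactive at \<open>xbar\<close> is split in half: one
    half absorbs the change of \<open>x\<close>, the other the change of \<open>b\<close>.\<close>
  define mid where "mid t = (a t \<bullet> xbar + bbar $ t) / 2" for t
  have gap: "a t \<bullet> xbar < mid t" "mid t < bbar $ t" if "t \<notin> ?A" for t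
  proof -
    have "a t \<bullet> xbar < bbar $ t"
      using xbar that by (auto simp: solution_set_def feasible_set_def active_set_def order_less_le)
    then show "a t \<bullet> xbar < mid t" "mid t < bbar $ t" by (simp_all add: mid_def)
  qed
  define U where "U = (\<Inter>t\<in>- ?A. {x. a t \<bullet> x < mid t})"
  \<comment> \<open>The second intersection is over finitely many \<open>E\<close>, and finitely
    generated cones are closed; so for nearby \<open>c\<close>, \<open>-c\<close> stays outside each
    cone that misses \<open>-cbar\<close>.\<close>
  define V :: "((real^'n) \<times> (real^'t)) set" where "V = (\<Inter>t\<in>- ?A. {y. mid t < snd y $ t}) \<inter>
    (\<Inter>E\<in>{E. - cbar \<notin> convex_cone hull (a ` E)}. (\<lambda>y. - fst y) -` (- (convex_cone hull (a ` E))))"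
  have "open U"
    unfolding U_def by (intro open_INT ballI open_Collect_less continuous_intros) simp
  have "open V"
    unfolding V_def
    by (intro open_Int open_INT ballI open_Collect_less open_vimage open_Compl
        closed_convex_cone_hull continuous_intros) simp_all
  have U: "openin (Metric_space.mtopology UNIV (\<lambda>x x'. N (x - x'))) U" "xbar \<in> U"
    using openin_mtopology_is_norm[OF N \<open>open U\<close>] gap by (simp_all add: U_def)
  have V: "openin (Metric_space.mtopology UNIV (\<lambda>y y'. param_norm N (y - y'))) V" "(cbar, bbar) \<in> V"
    using openin_mtopology_is_norm[OF is_norm_param_norm[OF N] \<open>open V\<close>] gap
    by (simp_all add: V_def)
  have bound: "(INF z\<in>solution_set a (cbar, bbar). ereal (N (x - z)))
      \<le> ereal (?k * param_norm N (y - (cbar, bbar)))"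
    if y: "y \<in> V" and x: "x \<in> solution_set a y \<inter> U" for x y
  proof -
    obtain c b where cb: "y = (c, b)" by (cases y)
    have x_sol: "x \<in> solution_set a (c, b)" using x cb by simp
    have sub: "active_set a b x \<subseteq> ?A"
    proof (rule subsetI, rule ccontr)
      fix t assume t: "t \<in> active_set a b x" "t \<notin> ?A"
      then have "a t \<bullet> x < mid t" "mid t < b $ t" using x y cb by (auto simp: U_def V_def)
      then show False using t by (simp add: active_set_def)
    qed
    \<comment> \<open>The KKT condition puts \<open>-c\<close> into the cone of the active set at
      \<open>x\<close>; by the choice of \<open>V\<close> that cone cannot miss
      \<open>-cbar\<close>.\<close>
    have "- cbar \<in> active_cone a b x"
      using solution_set_KKT[OF x_sol] y cb by (auto simp: V_def active_cone_def)
    then have "N (x - xbar) \<le> ?k * infnorm (b - bbar)"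
      using x_sol by (intro feasible_point_distance_bound[OF N int sub]) (auto simp: solution_set_def)
    also have "\<dots> \<le> ?k * param_norm N (y - (cbar, bbar))"
      using k by (intro mult_left_mono) (simp_all add: param_norm_def cb)
    \<comment> \<open>The distance to the solution set is bounded by the distance to its element
      \<open>xbar\<close>.\<close>
    finally show ?thesis
      using xbar by (intro INF_lower2[of xbar]) simp_all
  qed
  show ?thesis
    unfolding clm_def
  proof (rule Inf_lower, intro CollectI exI conjI ballI)
    show "(INF z\<in>solution_set a (cbar, bbar). ereal (N (x - z)))
        \<le> ereal (?k * param_norm N (y - (cbar, bbar)))"
      if "y \<in> V" "x \<in> solution_set a y \<inter> U" for x y
      using that by (rule bound)
  qed (use k U V in simp_all)
qed

end
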